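(* Let $\{u_n\}$, $\{\alpha_n\}$, and $\{\beta_n\}$ be sequences of real numbers with $\alpha_n \le \beta_n \le \alpha_n+1$ for all $n$. Suppose that both $\{\alpha_n\}$ and $\{\beta_n\}$ are monotone sequences. Then for every pair of positive integers $N$ and $H$, \[ |D_N| \ll \frac{N}{H} + \big( 1 + |\alpha_N-\alpha_1| + |\beta_N-\beta_1| \big) \sum_{h=1}^H M_N(h), \] with an absolute implied constant, where $M_N(h) = \max_{1\le T\le N} \big| \sum_{n=1}^T e(hu_n) \big|$.
   Context: Write $e(y)=e^{2\pi i y}$. Define \[ Z_N = \#\{1\le n\le N : u_n \in [\alpha_n,\beta_n] \pmod 1\}, \] where $u_n\in[\alpha_n,\beta_n] \pmod 1$ means that there is a real number $z$ with $\alpha_n\le z\le\beta_n$ and $u_n - z\in\mathbb{Z}$, and define \[ D_N = Z_N - \sum_{n=1}^N (\beta_n-\alpha_n). \] *)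

theory Defs
  imports "HOL-Analysis.Analysis"
begin

(* Sequences are functions on nat of which only the terms with index at least 1 are used. *)

definition e :: "real \<Rightarrow> complex" where
  "e y = exp (2 * of_real pi * \<i> * of_real y)"

definition in_interval_mod1 :: "real \<Rightarrow> real \<Rightarrow> real \<Rightarrow> bool" where
  "in_interval_mod1 x a b \<longleftrightarrow> (\<exists>z::real. a \<le> z \<and> z \<le> b \<and> x - z \<in> \<int>)"

definition Z :: "(nat \<Rightarrow> real) \<Rightarrow> (nat \<Rightarrow> real) \<Rightarrow> (nat \<Rightarrow> real) \<Rightarrow> nat \<Rightarrow> nat" where
  "Z u \<alpha> \<beta> N = card {n \<in> {1..N}. in_interval_mod1 (u n) (\<alpha> n) (\<beta> n)}"

definition D :: "(nat \<Rightarrow> real) \<Rightarrow> (nat \<Rightarrow> real) \<Rightarrow> (nat \<Rightarrow> real) \<Rightarrow> nat \<Rightarrow> real" where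
  "D u \<alpha> \<beta> N = real (Z u \<alpha> \<beta> N) - (\<Sum>n=1..N. \<beta> n - \<alpha> n)"

definition M :: "(nat \<Rightarrow> real) \<Rightarrow> nat \<Rightarrow> nat \<Rightarrow> real" where
  "M u N h = Max ((\<lambda>T. cmod (\<Sum>n=1..T. e (real h * u n))) ` {1..N})"

(* A monotone sequence may be nondecreasing or nonincreasing. The library's monoseq would also
   constrain the unused term with index 0. *)
definition monotone_seq :: "(nat \<Rightarrow> real) \<Rightarrow> bool" where
  "monotone_seq a \<longleftrightarrow> mono_on {1..} a \<or> antimono_on {1..} a"

end

theory Submission
  imports Defs
begin

text \<open>
  Up to the treatment of endpoints, the indicator of \<open>[a, b]\<close> modulo 1 minus its length is a sum of
  two sawtooth functions \<open>1/2 - frac\<close>, so \<open>D\<close> reduces to sums of the sawtooth over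
  \<open>u n - \<alpha> n\<close> and \<open>u n - \<beta> n\<close>. Such a sum, as a function \<open>g\<close> of a common shift of its arguments,
  increases at rate at most \<open>N\<close> and only jumps downwards, so on one side of a point where \<open>\<bar>g\<bar>\<close> attains its maximum \<open>A\<close>
  there is an interval of length about \<open>1/H\<close> on which \<open>\<bar>g\<bar>\<close> stays close to \<open>A\<close>. Averaging
  \<open>g\<close> against a Fejer kernel of degree below \<open>H\<close> centred there gives at least \<open>A/2 - O(N/H)\<close> in
  absolute value, while the Fourier expansion of this average only involves
  \<open>1/h\<close> times exponential sums of frequency at most \<open>H\<close>. Working on the grid of multiples of
  \<open>1/q\<close> with \<open>q = 4 H\<^sup>2\<close> replaces all integrals by finite sums at a cost of \<open>O(N/H)\<close>. Finally, partial
  summation removes the monotone sequence from an exponential sum of frequency \<open>h\<close> at the cost of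
  a factor \<open>1 + 2 \<pi> h \<bar>\<gamma> N - \<gamma> 1\<bar>\<close>; the weight \<open>1/h\<close> compensates the \<open>h\<close>.
\<close>

section \<open>The exponential \<open>e\<close> on the unit circle\<close>

lemma e_add: "e (x + y) = e x * e y"
  by (simp add: e_def exp_add algebra_simps)

lemma e_of_int [simp]: "e (of_int k) = 1"
  using exp_integer_2pi[of "of_int k"] by (simp add: e_def mult_ac)

lemma e_of_nat [simp]: "e (real n) = 1"
  using e_of_int[of "int n"] by simp

lemma e_0 [simp]: "e 0 = 1"
  by (simp add: e_def)

lemma e_minus: "e (- x) = cnj (e x)"
  by (simp add: e_def exp_cnj)

lemma e_power: "e x ^ n = e (real n * x)"
  by (simp add: e_def exp_of_nat_mult [symmetric] mult_ac)

lemma norm_e [simp]: "cmod (e x) = 1"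
  using norm_exp_i_times[of "2 * pi * x"] by (simp add: e_def mult_ac)

lemma norm_e_minus_1: "cmod (e x - 1) = 2 * \<bar>sin (pi * x)\<bar>"
  using dist_exp_i_1[of "2 * pi * x"] by (simp add: e_def mult_ac)

lemma norm_e_diff_le: "cmod (e x - e y) \<le> 2 * pi * \<bar>x - y\<bar>"
proof -
  have "e x - e y = e y * (e (x - y) - 1)"
    by (simp add: algebra_simps flip: e_add)
  then have "cmod (e x - e y) = 2 * \<bar>sin (pi * (x - y))\<bar>"
    by (simp add: norm_mult norm_e_minus_1)
  also have "\<dots> \<le> 2 * \<bar>pi * (x - y)\<bar>"
    using abs_sin_x_le_abs_x by simp
  finally show ?thesis by (simp add: abs_mult)
qed

text \<open>Concavity puts the sine above its chord from 0 to \<open>pi/2\<close>. This bounds the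
  denominators \<open>z - 1\<close> of the geometric sums below away from 0.\<close>

lemma norm_e_minus_1_ge:
  assumes "\<bar>x\<bar> \<le> 1/2"
  shows "4 * \<bar>x\<bar> \<le> cmod (e x - 1)"
proof -
  have "concave_on {0..pi} sin"
    by (rule f''_le0_imp_concave[where f' = cos and f'' = "\<lambda>x. - sin x"])
      (auto intro!: derivative_eq_intros sin_ge_zero)
  then have "2 * \<bar>x\<bar> * sin (pi/2) \<le> sin ((1 - 2 * \<bar>x\<bar>) *\<^sub>R 0 + (2 * \<bar>x\<bar>) *\<^sub>R (pi/2))"
    using concave_onD[of "{0..pi}" sin "2 * \<bar>x\<bar>" 0 "pi/2"] assms by simp
  then have "2 * \<bar>x\<bar> \<le> sin (pi * \<bar>x\<bar>)"
    by (simp add: mult_ac)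
  also have "\<dots> \<le> \<bar>sin (pi * x)\<bar>"
    by (cases "x \<ge> 0") auto
  finally show ?thesis by (simp add: norm_e_minus_1)
qed

lemma e_ne_1:
  assumes "0 < \<bar>x\<bar>" "\<bar>x\<bar> < 1"
  shows "e x \<noteq> 1"
proof -
  have "sin (pi * \<bar>x\<bar>) > 0"
    using assms by (intro sin_gt_zero) auto
  then have "sin (pi * x) \<noteq> 0"
    by (cases "x \<ge> 0") auto
  then show ?thesis using norm_e_minus_1[of x] by auto
qed

section \<open>Sums over a full period\<close>

lemma periodic_mod:
  fixes f :: "int \<Rightarrow> 'a"
  assumes "\<And>j. f (j + Q) = f j"
  shows "f (j mod Q) = f j"
proof -
  have "f (i + int n * Q) = f i" for i n
  proof (induction n)
    case (Suc n)
    then show ?case using assms[of "i + int n * Q"] by (simp add: algebra_simps)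
  qed simp
  note * = this
  \<comment> \<open>For negative \<open>m\<close>, the walk starts at \<open>i + m * Q\<close> and
    reaches \<open>i\<close> after \<open>- m\<close> forward periods.\<close>
  have "f (i + m * Q) = f i" for i m
    using *[of i "nat m"] *[of "i + m * Q" "nat (- m)"] by (cases "m \<ge> 0") auto
  from this[of "j mod Q" "j div Q"] show ?thesis by simp
qed

text \<open>Sending \<open>j\<close> to \<open>m - j\<close> permutes the residues modulo
  \<open>Q\<close>. This moves a convolution over any window to one fixed period.\<close>

lemma sum_reflect_periodic:
  fixes f :: "int \<Rightarrow> 'a::comm_monoid_add"
  assumes "\<And>j. f (j + Q) = f j" "Q > 0"
  shows "(\<Sum>j\<in>{a..<a+Q}. f (m - j)) = (\<Sum>j\<in>{0..<Q}. f j)"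
proof -
  let ?h = "\<lambda>j. (m - j) mod Q"
  have inj: "inj_on ?h {a..<a+Q}"
  proof (rule inj_onI)
    fix x y assume xy: "x \<in> {a..<a+Q}" "y \<in> {a..<a+Q}" "?h x = ?h y"
    then have "Q dvd y - x" by (simp add: mod_eq_dvd_iff)
    with xy show "x = y"
      using zdvd_imp_le[of Q "y - x"] zdvd_imp_le[of Q "x - y"]
      by (smt (verit) atLeastLessThan_iff dvd_diff_commute)
  qed
  have "?h ` {a..<a+Q} = {0..<Q}"
  proof (rule card_subset_eq)
    show "card (?h ` {a..<a+Q}) = card {0..<Q}"
      using card_image[OF inj] by simp
  qed (use assms in auto)
  with inj have "bij_betw ?h {a..<a+Q} {0..<Q}" by (simp add: bij_betw_def)
  then have "(\<Sum>j\<in>{0..<Q}. f j) = (\<Sum>j\<in>{a..<a+Q}. f (?h j))"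
    by (rule sum.reindex_bij_betw[symmetric])
  then show ?thesis using periodic_mod[of f Q, OF assms(1)] by simp
qed

lemma sum_int_atLeastLessThan:
  "(\<Sum>j\<in>{0..<int q}. f j) = (\<Sum>k<q. f (int k))"
proof -
  have "int ` {0..<q} = {0..<int q}" using image_int_atLeastLessThan[of 0 q] by simp
  then have "(\<Sum>j\<in>{0..<int q}. f j) = (\<Sum>k\<in>{0..<q}. f (int k))"
    by (metis (no_types, lifting) inj_on_of_nat sum.reindex_cong)
  then show ?thesis by (simp add: lessThan_atLeast0)
qed

section \<open>The discrete sawtooth and its Fourier coefficients\<close>

text \<open>At a \<open>q\<close>-th root of unity other than 1 the second sum vanishes, which
  leaves \<open>q / (z - 1)\<close> for the first.\<close>

lemma sum_of_nat_mult_power: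
  fixes z :: complex
  shows "(\<Sum>k<q. of_nat k * z ^ k) * (z - 1) + (\<Sum>k<q. z ^ k) * z = of_nat q * z ^ q"
  by (induction q) (auto simp: algebra_simps)

lemma sum_e_full_period:
  assumes "q > 0" "h \<noteq> 0" "\<bar>h\<bar> < int q"
  shows "(\<Sum>k<q. e (of_int h * real k / real q)) = 0"
proof -
  define z where "z = e (of_int h / real q)"
  have "z \<noteq> 1" unfolding z_def
    using assms by (intro e_ne_1) (auto simp: field_simps)
  moreover have "z ^ q = 1" using assms by (simp add: z_def e_power)
  ultimately have "(\<Sum>k<q. z ^ k) = 0" by (simp add: sum_gp_strict)
  then show ?thesis by (simp add: z_def e_power mult_ac)
qed

text \<open>The last term makes the mean over a period equal to 0.\<close>

definition saw :: "nat \<Rightarrow> int \<Rightarrow> real" where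
  "saw q j = of_int (j mod int q) / real q - 1/2 + 1 / (2 * real q)"

lemma saw_periodic: "saw q (j + int q) = saw q j"
  by (simp add: saw_def)

text \<open>Reduction modulo \<open>q\<close> never raises a nonnegative integer, so wrapping around
  is a downward jump. The plateau argument rests on this one-sided Lipschitz bound.\<close>

lemma saw_Suc_le:
  assumes "q > 0"
  shows "saw q (j + 1) \<le> saw q j + 1 / real q"
proof -
  have "(j mod int q + 1) mod int q \<le> j mod int q + 1"
    using assms by (intro zmod_le_nonneg_dividend) simp
  then have "(j + 1) mod int q \<le> j mod int q + 1"
    by (simp only: mod_add_left_eq)
  then have "real_of_int ((j + 1) mod int q) \<le> of_int (j mod int q) + 1" by linarith
  then have "real_of_int ((j + 1) mod int q) / real q \<le> (of_int (j mod int q) + 1) / real q"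
    by (rule divide_right_mono) simp
  then show ?thesis by (simp add: saw_def add_divide_distrib)
qed

text \<open>Makes frequency 0 drop out of the convolution with the Fejer kernel.\<close>

lemma saw_fourier_0:
  assumes "q > 0"
  shows "(\<Sum>j\<in>{0..<int q}. saw q j) = 0"
proof -
  have *: "(\<Sum>k<n. real k) = real n * (real n - 1) / 2" for n
    by (induction n) (auto simp: field_simps)
  have "(\<Sum>j\<in>{0..<int q}. saw q j) = (\<Sum>k<q. real k) / real q - real q / 2 + 1/2"
    using assms unfolding sum_int_atLeastLessThan
    by (simp add: saw_def sum.distrib sum_subtractf flip: sum_divide_distrib)
  then show ?thesis using assms by (simp add: * field_simps)
qed

text \<open>The constants in \<open>saw\<close> sum to 0 against the powers of \<open>z\<close>, and
  the linear term makes the coefficient exactly \<open>1 / (z - 1)\<close>.\<close>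

lemma norm_saw_fourier:
  assumes "q > 0" "h \<noteq> 0" "2 * \<bar>h\<bar> \<le> int q"
  shows "cmod (\<Sum>j\<in>{0..<int q}. of_real (saw q j) * e (of_int (h * j) / real q)) \<le> real q / (4 * of_int \<bar>h\<bar>)"
proof -
  define z where "z = e (of_int h / real q)"
  define S where "S = (\<Sum>j\<in>{0..<int q}. of_real (saw q j) * e (of_int (h * j) / real q))"
  have z1: "z \<noteq> 1" unfolding z_def
    using assms by (intro e_ne_1) (auto simp: field_simps)
  have zq: "z ^ q = 1" using assms by (simp add: z_def e_power)
  have s0: "(\<Sum>k<q. z ^ k) = 0" using z1 zq by (simp add: sum_gp_strict)
  have "S = (\<Sum>k<q. (of_nat k / of_nat q - 1/2 + 1 / (2 * of_nat q)) * z ^ k)"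
    unfolding S_def sum_int_atLeastLessThan
    by (intro sum.cong refl) (auto simp: saw_def z_def e_power mult_ac)
  also have "\<dots> = (\<Sum>k<q. of_nat k * z ^ k) / of_nat q + (1 / (2 * of_nat q) - 1/2) * (\<Sum>k<q. z ^ k)"
    unfolding sum_divide_distrib sum_distrib_left sum.distrib[symmetric]
    by (intro sum.cong refl) (auto simp: algebra_simps)
  finally have "S * (z - 1) = (\<Sum>k<q. of_nat k * z ^ k) * (z - 1) / of_nat q" by (simp add: s0)
  also have "\<dots> = 1" using sum_of_nat_mult_power[of z q] assms by (simp add: s0 zq)
  finally have "cmod S * cmod (z - 1) = 1" by (metis norm_mult norm_one)
  moreover have "4 * of_int \<bar>h\<bar> / real q \<le> cmod (z - 1)"
    using norm_e_minus_1_ge[of "of_int h / real q"] assms by (simp add: z_def field_simps)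
  ultimately have "cmod S * (4 * of_int \<bar>h\<bar> / real q) \<le> 1"
    by (metis mult_left_mono norm_ge_zero)
  then show ?thesis using assms by (simp add: S_def field_simps)
qed

section \<open>From an averaged bound to a pointwise bound\<close>

text \<open>
  The mass of the kernel outside \<open>[-J, J]\<close> is a quarter of the total, so the opposite sign of \<open>g\<close>
  there costs at most half of the main term.
\<close>

lemma bound_at_plateau:
  fixes g K :: "int \<Rightarrow> real" and s :: real
  assumes K: "\<And>j. K j \<ge> 0" and R: "R > 0"
    and total: "(\<Sum>j\<in>{-R..<R}. K j) = 2 * of_int R"
    and tail: "(\<Sum>j\<in>{-R..<R} - {-J..J}. K j) \<le> of_int R / 2"
    and B: "\<bar>\<Sum>j\<in>{-R..<R}. g (c - j) * K j\<bar> \<le> B"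
    and A: "\<And>j. \<bar>g j\<bar> \<le> A" and s: "\<bar>s\<bar> = 1"
    and plateau: "\<And>j. \<bar>j\<bar> \<le> J \<Longrightarrow> s * g (c - j) \<ge> A - d" and "d \<ge> 0"
  shows "A \<le> 2 * d + B / of_int R"
proof -
  let ?I = "{-R..<R}" and ?T = "{-R..<R} - {-J..J}"
  have A0: "A \<ge> 0" using A[of 0] by linarith
  have sg: "\<bar>s * g j\<bar> \<le> A" for j using A[of j] s by (simp add: abs_mult)
  \<comment> \<open>Claiming \<open>A - d\<close> everywhere and taking back \<open>2 * A\<close> on
    the tail leaves \<open>- A - d\<close> there, a trivial lower bound for
    \<open>s * g\<close>.\<close>
  have "(\<Sum>j\<in>?I. (A - d) * K j) - (\<Sum>j\<in>?T. 2 * A * K j)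
      = (\<Sum>j\<in>?I. (A - d) * K j - (if j \<in> ?T then 2 * A * K j else 0))"
  proof -
    have "(\<Sum>j\<in>?T. 2 * A * K j) = (\<Sum>j\<in>?I. if j \<in> ?T then 2 * A * K j else 0)"
      by (rule sum.mono_neutral_cong_left) auto
    then show ?thesis by (simp only: sum_subtractf)
  qed
  also have "\<dots> \<le> (\<Sum>j\<in>?I. s * g (c - j) * K j)"
  proof (rule sum_mono)
    fix j assume j: "j \<in> ?I"
    show "(A - d) * K j - (if j \<in> ?T then 2 * A * K j else 0) \<le> s * g (c - j) * K j"
    proof (cases "j \<in> ?T")
      case True
      have "(A - d) - 2 * A \<le> s * g (c - j)" using sg[of "c - j"] \<open>d \<ge> 0\<close> by linarith
      then have "((A - d) - 2 * A) * K j \<le> s * g (c - j) * K j" using K by (rule mult_right_mono)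
      with True show ?thesis by (simp add: algebra_simps)
    next
      case False
      with j have "\<bar>j\<bar> \<le> J" by auto
      then have "(A - d) * K j \<le> s * g (c - j) * K j" by (intro mult_right_mono plateau K)
      then show ?thesis by (simp only: False if_False diff_0_right)
    qed
  qed
  also have "\<dots> = s * (\<Sum>j\<in>?I. g (c - j) * K j)" by (simp add: sum_distrib_left mult.assoc)
  also have "\<dots> \<le> \<bar>s * (\<Sum>j\<in>?I. g (c - j) * K j)\<bar>" by simp
  also have "\<dots> \<le> B" using B s by (simp add: abs_mult)
  finally have "(A - d) * (2 * of_int R) - 2 * A * (\<Sum>j\<in>?T. K j) \<le> B"
    unfolding sum_distrib_left[symmetric] total .
  \<comment> \<open>The tail removes at most \<open>A * R\<close> from the main term
    \<open>2 * A * R\<close>.\<close>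
  moreover have "2 * A * (\<Sum>j\<in>?T. K j) \<le> 2 * A * (of_int R / 2)"
    using tail A0 by (intro mult_left_mono) auto
  ultimately have "A * of_int R \<le> 2 * d * of_int R + B" by (simp add: algebra_simps)
  then show ?thesis using R by (simp add: field_simps)
qed

text \<open>Let \<open>\<bar>g\<bar>\<close> be largest at \<open>m\<close>. The one-sided Lipschitz
  bound keeps a positive value nearly as large for \<open>2 * J\<close> steps to the left of
  \<open>m\<close>, and a negative one for \<open>2 * J\<close> steps to the right.\<close>

lemma sup_le_convolution:
  fixes g K :: "int \<Rightarrow> real"
  assumes periodic: "\<And>j. g (j + 2 * R) = g j"
    and lip: "\<And>j. g (j + 1) \<le> g j + \<epsilon>" and "\<epsilon> \<ge> 0"
    and K: "\<And>j. K j \<ge> 0" and R: "R > 0" and J: "J \<ge> 0"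
    and total: "(\<Sum>j\<in>{-R..<R}. K j) = 2 * of_int R"
    and tail: "(\<Sum>j\<in>{-R..<R} - {-J..J}. K j) \<le> of_int R / 2"
    and B: "\<And>c. \<bar>\<Sum>j\<in>{-R..<R}. g (c - j) * K j\<bar> \<le> B"
  shows "\<bar>g i\<bar> \<le> 4 * of_int J * \<epsilon> + B / of_int R"
proof -
  define A where "A = Max ((\<lambda>j. \<bar>g j\<bar>) ` {0..<2*R})"
  have "A \<in> (\<lambda>j. \<bar>g j\<bar>) ` {0..<2*R}"
    unfolding A_def using R by (intro Max_in) auto
  then obtain m where m: "A = \<bar>g m\<bar>" by blast
  have A: "\<bar>g j\<bar> \<le> A" for j
  proof -
    have "\<bar>g (j mod (2*R))\<bar> \<le> A" unfolding A_def using R by (intro Max_ge) auto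
    then show ?thesis using periodic_mod[of g "2*R" j, OF periodic] by simp
  qed
  have step: "g (j + int t) \<le> g j + real t * \<epsilon>" for j t
  proof (induction t)
    case (Suc t)
    then show ?case using lip[of "j + int t"] by (simp add: algebra_simps)
  qed simp
  have lip': "g b \<le> g a + 2 * of_int J * \<epsilon>" if "a \<le> b" "b \<le> a + 2 * J" for a b
  proof -
    have "real (nat (b - a)) * \<epsilon> \<le> 2 * of_int J * \<epsilon>"
      using that \<open>\<epsilon> \<ge> 0\<close> by (intro mult_right_mono) linarith+
    then show ?thesis using step[of a "nat (b - a)"] that by simp
  qed
  have d: "0 \<le> 2 * of_int J * \<epsilon>" using J \<open>\<epsilon> \<ge> 0\<close> by simp
  note plateau = bound_at_plateau[OF K R total tail B A _ _ d]
  have "A \<le> 2 * (2 * of_int J * \<epsilon>) + B / of_int R"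
  proof (cases "g m \<ge> 0")
    case True
    show ?thesis
    \<comment> \<open>With this centre the arguments \<open>c - j\<close> for
      \<open>\<bar>j\<bar> \<le> J\<close> fill \<open>{m - 2 * J..m}\<close>; the centre
      \<open>m + J\<close> of the other case gives \<open>{m..m + 2 * J}\<close>.\<close>
    proof (rule plateau[of 1 "m - J"])
      fix j :: int assume "\<bar>j\<bar> \<le> J"
      then show "A - 2 * of_int J * \<epsilon> \<le> 1 * g (m - J - j)"
        using lip'[of "m - J - j" m] m True by (simp add: abs_le_iff)
    qed simp
  next
    case False
    show ?thesis
    proof (rule plateau[of "-1" "m + J"])
      fix j :: int assume "\<bar>j\<bar> \<le> J"
      then show "A - 2 * of_int J * \<epsilon> \<le> - 1 * g (m + J - j)"
        using lip'[of m "m + J - j"] m False by (simp add: abs_le_iff)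
    qed simp
  qed
  with A[of i] show ?thesis by linarith
qed

section \<open>The discrete Fejer kernel\<close>

lemma sum_swap3:
  "(\<Sum>j\<in>A. \<Sum>k\<in>B. \<Sum>l\<in>C. f j k l) = (\<Sum>k\<in>B. \<Sum>l\<in>C. \<Sum>j\<in>A. f j k l)"
  by (subst sum.swap) (intro sum.cong refl sum.swap)

text \<open>The Fejer kernel sampled at \<open>j / q\<close>. As a squared modulus it is visibly
  nonnegative, and its decay follows from a geometric sum.\<close>

definition fejer :: "nat \<Rightarrow> nat \<Rightarrow> int \<Rightarrow> real" where
  "fejer H q j = (cmod (\<Sum>k<H. e (real k * of_int j / real q)))\<^sup>2 / real H"

lemma fejer_nonneg: "fejer H q j \<ge> 0"
  by (simp add: fejer_def)

text \<open>The squared modulus is the product with the conjugate. All frequencies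
  \<open>k - l\<close> lie strictly between \<open>- H\<close> and \<open>H\<close>.\<close>

lemma of_real_fejer:
  "complex_of_real (fejer H q j) =
    (\<Sum>k<H. \<Sum>l<H. e (of_int ((int k - int l) * j) / real q)) / of_nat H"
proof -
  let ?S = "\<Sum>k<H. e (real k * of_int j / real q)"
  have "?S * cnj ?S = (\<Sum>k<H. \<Sum>l<H. e (real k * of_int j / real q) * e (- (real l * of_int j / real q)))"
    by (simp add: e_minus sum_product)
  also have "\<dots> = (\<Sum>k<H. \<Sum>l<H. e (of_int ((int k - int l) * j) / real q))"
    by (intro sum.cong refl) (simp add: algebra_simps diff_divide_distrib flip: e_add)
  finally show ?thesis
    unfolding fejer_def of_real_divide complex_norm_square by simp
qed

lemma e_periodic_mult:
  assumes "q > 0"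
  shows "e (of_int (h * (j + int q)) / real q) = e (of_int (h * j) / real q)"
proof -
  have "of_int (h * (j + int q)) / real q = of_int (h * j) / real q + of_int h"
    using assms by (simp add: field_simps)
  then show ?thesis by (simp only: e_add e_of_int mult_1_right)
qed

text \<open>By orthogonality only the \<open>H\<close> diagonal terms survive, each equal to
  \<open>q\<close>; \<open>H \<le> q\<close> keeps the other frequencies nonzero modulo
  \<open>q\<close>.\<close>

lemma sum_fejer:
  assumes "0 < H" "H \<le> q"
  shows "(\<Sum>j\<in>{a..<a + int q}. fejer H q j) = real q"
proof -
  have q: "q > 0" using assms by simp
  have "(\<Sum>j\<in>{a..<a + int q}. e (of_int (h * j) / real q)) = (if h = 0 then of_nat q else 0)"
    if "\<bar>h\<bar> < int q" for h
  proof -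
    \<comment> \<open>Reflecting both the index and the frequency only shifts the window to
      \<open>{0..<int q}\<close>.\<close>
    have "(\<Sum>j\<in>{a..<a + int q}. e (of_int ((-h) * (0 - j)) / real q)) = (\<Sum>j\<in>{0..<int q}. e (of_int ((-h) * j) / real q))"
      using q e_periodic_mult[OF q, of "-h"] by (intro sum_reflect_periodic) auto
    then show ?thesis
      using sum_e_full_period[of q "-h"] that q by (auto simp: sum_int_atLeastLessThan)
  qed
  note orth = this
  have "complex_of_real (\<Sum>j\<in>{a..<a + int q}. fejer H q j)
    = (\<Sum>j\<in>{a..<a + int q}. \<Sum>k<H. \<Sum>l<H. e (of_int ((int k - int l) * j) / real q)) / of_nat H"
    by (simp add: of_real_fejer sum_divide_distrib)
  also have "\<dots> = (\<Sum>k<H. \<Sum>l<H. \<Sum>j\<in>{a..<a + int q}. e (of_int ((int k - int l) * j) / real q)) / of_nat H"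
    by (subst sum_swap3) (rule refl)
  also have "\<dots> = (\<Sum>k<H. \<Sum>l<H. if k = l then of_nat q else 0) / of_nat H"
    using assms by (intro arg_cong2[where f = "(/)"] sum.cong refl) (subst orth, auto)
  also have "\<dots> = of_real (real q)" using assms by simp
  finally show ?thesis by (simp only: of_real_eq_iff)
qed

text \<open>The geometric sum has numerator at most 2 in modulus and denominator at least
  \<open>4 * \<bar>j\<bar> / q\<close>.\<close>

lemma fejer_le:
  assumes "q > 0" "H > 0" "j \<noteq> 0" "2 * \<bar>j\<bar> \<le> int q"
  shows "fejer H q j \<le> (real q)\<^sup>2 / (4 * real H * (of_int j)\<^sup>2)"
proof -
  define z where "z = e (of_int j / real q)"
  define S where "S = (\<Sum>k<H. z ^ k)"
  have "cmod (S * (1 - z)) = cmod (1 - z ^ H)"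
    using one_diff_power_eq[of z H] by (simp add: S_def mult.commute)
  also have "\<dots> \<le> 2" using norm_triangle_ineq4[of 1 "z ^ H"] by (simp add: z_def norm_power)
  finally have "cmod S * cmod (z - 1) \<le> 2" by (simp add: norm_mult norm_minus_commute)
  moreover have "4 * of_int \<bar>j\<bar> / real q \<le> cmod (z - 1)"
    using norm_e_minus_1_ge[of "of_int j / real q"] assms by (simp add: z_def field_simps)
  ultimately have "cmod S * (4 * of_int \<bar>j\<bar> / real q) \<le> 2"
    by (meson mult_left_mono norm_ge_zero order_trans)
  then have "cmod S \<le> real q / (2 * of_int \<bar>j\<bar>)" using assms by (simp add: field_simps)
  then have "(cmod S)\<^sup>2 \<le> (real q / (2 * of_int \<bar>j\<bar>))\<^sup>2" by (rule power_mono) simp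
  moreover have "fejer H q j = (cmod S)\<^sup>2 / real H"
    by (simp add: fejer_def S_def z_def e_power)
  ultimately have "fejer H q j \<le> (real q / (2 * of_int \<bar>j\<bar>))\<^sup>2 / real H"
    by (simp add: divide_right_mono)
  then show ?thesis by (simp add: power_divide power_mult_distrib mult_ac)
qed

text \<open>Comparison with a telescoping sum; the negative term on the right carries the
  induction.\<close>

lemma sum_inverse_squares_le:
  assumes "0 < J"
  shows "(\<Sum>j\<in>{J<..J + n}. 1 / (real j)\<^sup>2) \<le> 1 / real J - 1 / real (J + n)"
proof (induction n)
  case (Suc n)
  define x where "x = real (J + n)"
  have x: "x > 0" using assms by (simp add: x_def)
  have "1 / (x + 1)\<^sup>2 \<le> 1 / (x * (x + 1))"
    using x by (intro divide_left_mono) (auto simp: power2_eq_square)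
  also have "\<dots> = 1 / x - 1 / (x + 1)" using x by (simp add: field_simps)
  finally have "1 / (x + 1)\<^sup>2 \<le> 1 / x - 1 / (x + 1)" .
  moreover have "{J<..J + Suc n} = insert (Suc (J + n)) {J<..J + n}" by auto
  ultimately show ?case using Suc by (simp add: x_def algebra_simps)
qed simp

lemma fejer_tail:
  assumes "0 < R" "0 < H" "0 < J"
  shows "(\<Sum>j\<in>{- int R..<int R} - {- int J..int J}. fejer H (2 * R) j) \<le> 2 * (real R)\<^sup>2 / (real H * real J)"
proof -
  let ?T = "{J<..J + R}" and ?f = "\<lambda>j::int. (real (2 * R))\<^sup>2 / (4 * real H * (of_int j)\<^sup>2)"
  have "(\<Sum>j\<in>{- int R..<int R} - {- int J..int J}. fejer H (2 * R) j)
      \<le> (\<Sum>j\<in>{- int R..<int R} - {- int J..int J}. ?f j)"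
    using assms by (intro sum_mono fejer_le) auto
  \<comment> \<open>The tail is enlarged to \<open>?T\<close> and its negative, where the inverse
    squares can be summed.\<close>
  also have "\<dots> \<le> (\<Sum>j\<in>int ` ?T \<union> (\<lambda>j. - int j) ` ?T. ?f j)"
  proof (rule sum_mono2)
    show "{- int R..<int R} - {- int J..int J} \<subseteq> int ` ?T \<union> (\<lambda>j. - int j) ` ?T"
    proof
      fix j assume j: "j \<in> {- int R..<int R} - {- int J..int J}"
      show "j \<in> int ` ?T \<union> (\<lambda>j. - int j) ` ?T"
      proof (cases "j \<ge> 0")
        case True
        then have "j = int (nat j)" "nat j \<in> ?T" using j by auto
        then show ?thesis by blast
      next
        case False
        then have "j = - int (nat (- j))" "nat (- j) \<in> ?T" using j by auto
        then show ?thesis by blast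
      qed
    qed
  qed auto
  also have "\<dots> \<le> (\<Sum>j\<in>int ` ?T. ?f j) + (\<Sum>j\<in>(\<lambda>j. - int j) ` ?T. ?f j)"
    by (subst sum.union_inter[symmetric]) (auto intro!: sum_nonneg)
  also have "\<dots> = 2 * (real R)\<^sup>2 / real H * (\<Sum>j\<in>?T. 1 / (real j)\<^sup>2)"
    by (simp add: sum.reindex inj_on_def sum_distrib_left power_mult_distrib mult_ac flip: sum.distrib)
  also have "\<dots> \<le> 2 * (real R)\<^sup>2 / real H * (1 / real J)"
    using sum_inverse_squares_le[OF \<open>0 < J\<close>, of R] 
    by (intro mult_left_mono) (auto intro: order_trans)
  finally show ?thesis by simp
qed

section \<open>Sawtooth sums against the Fejer kernel\<close>

text \<open>A difference \<open>h\<close> comes from at most two values of \<open>l\<close>, one on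
  each side of \<open>k\<close>.\<close>

lemma sum_abs_diff_le:
  fixes w :: "nat \<Rightarrow> real"
  assumes "\<And>h. w h \<ge> 0" "w 0 = 0" "k < H"
  shows "(\<Sum>l<H. w (nat \<bar>int k - int l\<bar>)) \<le> 2 * (\<Sum>h=1..H. w h)"
proof -
  have part: "(\<Sum>l\<in>X. w (nat \<bar>int k - int l\<bar>)) \<le> (\<Sum>h=1..H. w h)"
    if "inj_on (\<lambda>l. nat \<bar>int k - int l\<bar>) X" "X \<subseteq> {..<H}" for X
  proof -
    have "(\<Sum>l\<in>X. w (nat \<bar>int k - int l\<bar>)) = (\<Sum>h\<in>(\<lambda>l. nat \<bar>int k - int l\<bar>) ` X. w h)"
      using that by (simp add: sum.reindex)
    also have "\<dots> \<le> (\<Sum>h\<in>{0..H}. w h)"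
      using that assms by (intro sum_mono2) auto
    also have "\<dots> = (\<Sum>h=1..H. w h)" using assms by (simp add: sum.atLeast_Suc_atMost)
    finally show ?thesis .
  qed
  have split: "{..<H} = {..k} \<union> {k<..<H}" using assms by auto
  have "(\<Sum>l<H. w (nat \<bar>int k - int l\<bar>))
      = (\<Sum>l\<in>{..k}. w (nat \<bar>int k - int l\<bar>)) + (\<Sum>l\<in>{k<..<H}. w (nat \<bar>int k - int l\<bar>))"
    unfolding split by (rule sum.union_disjoint) auto
  moreover have "(\<Sum>l\<in>{..k}. w (nat \<bar>int k - int l\<bar>)) \<le> (\<Sum>h=1..H. w h)"
    using assms by (intro part) (auto simp: inj_on_def)
  moreover have "(\<Sum>l\<in>{k<..<H}. w (nat \<bar>int k - int l\<bar>)) \<le> (\<Sum>h=1..H. w h)"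
    using assms by (intro part) (auto simp: inj_on_def)
  ultimately show ?thesis by linarith
qed

text \<open>Changing the sign of the frequency conjugates the sum.\<close>

lemma norm_sum_e_abs:
  "cmod (\<Sum>n\<in>I. e (of_int h * y n)) = cmod (\<Sum>n\<in>I. e (real (nat \<bar>h\<bar>) * y n))"
proof (cases "h \<ge> 0")
  case False
  then have "of_int h * y n = - (real (nat \<bar>h\<bar>) * y n)" for n by simp
  then have "(\<Sum>n\<in>I. e (of_int h * y n)) = cnj (\<Sum>n\<in>I. e (real (nat \<bar>h\<bar>) * y n))"
    by (simp only: e_minus cnj_sum)
  then show ?thesis by (simp only: complex_mod_cnj)
qed simp

text \<open>For \<open>h = 0\<close> the right-hand side is 0 because of \<open>x / 0 = 0\<close>.\<close>

lemma norm_saw_twisted: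
  assumes "q > 0" "2 * \<bar>h\<bar> \<le> int q"
  shows "cmod (\<Sum>j\<in>{a..<a + int q}. (\<Sum>n\<in>I. of_real (saw q (x n + c - j))) * e (of_int (h * j) / real q))
    \<le> real q / 4 * (cmod (\<Sum>n\<in>I. e (real (nat \<bar>h\<bar>) * (of_int (x n) / real q))) / real (nat \<bar>h\<bar>))"
proof -
  define F where "F = (\<lambda>i. of_real (saw q i) * e (of_int ((-h) * i) / real q))"
  define S where "S = (\<Sum>i\<in>{0..<int q}. F i)"
  have per: "F (j + int q) = F j" for j
    unfolding F_def e_periodic_mult[OF \<open>q > 0\<close>] saw_periodic ..
  \<comment> \<open>Writing \<open>j = m - (m - j)\<close> leaves the phase of \<open>m\<close>
    times a function of \<open>m - j\<close>. Its sum over a period is the same coefficient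
    \<open>S\<close> for all \<open>m\<close>.\<close>
  have split: "of_real (saw q (m - j)) * e (of_int (h * j) / real q) = e (of_int (h * m) / real q) * F (m - j)" for m j
    by (simp add: F_def mult_ac algebra_simps add_divide_distrib diff_divide_distrib flip: e_add)
  have "(\<Sum>j\<in>{a..<a + int q}. (\<Sum>n\<in>I. of_real (saw q (x n + c - j))) * e (of_int (h * j) / real q))
      = (\<Sum>n\<in>I. \<Sum>j\<in>{a..<a + int q}. of_real (saw q (x n + c - j)) * e (of_int (h * j) / real q))"
    by (subst sum.swap) (simp add: sum_distrib_right)
  also have "\<dots> = (\<Sum>n\<in>I. e (of_int (h * (x n + c)) / real q) * S)"
    unfolding S_def sum_distrib_left[symmetric] split
    by (intro sum.cong refl arg_cong2[where f = "(*)"] sum_reflect_periodic[of F "int q", OF per]) (use \<open>q > 0\<close> in simp)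
  also have "\<dots> = S * e (of_int (h * c) / real q) * (\<Sum>n\<in>I. e (of_int h * (of_int (x n) / real q)))"
    unfolding sum_distrib_left
    by (intro sum.cong refl) (simp add: algebra_simps add_divide_distrib e_add)
  finally have eq: "cmod (\<Sum>j\<in>{a..<a + int q}. (\<Sum>n\<in>I. of_real (saw q (x n + c - j))) * e (of_int (h * j) / real q))
      = cmod S * cmod (\<Sum>n\<in>I. e (real (nat \<bar>h\<bar>) * (of_int (x n) / real q)))"
    by (simp only: norm_mult norm_e mult_1_right norm_sum_e_abs[where h = h])
  show ?thesis
  proof (cases "h = 0")
    case True
    have "S = of_real (\<Sum>j\<in>{0..<int q}. saw q j)" unfolding S_def F_def True by simp
    then have "S = 0" using saw_fourier_0[OF \<open>q > 0\<close>] by simp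
    with eq show ?thesis by simp
  next
    case False
    have "cmod S \<le> real q / (4 * of_int \<bar>h\<bar>)"
      using norm_saw_fourier[of q "-h"] assms False by (simp add: S_def F_def)
    then have "cmod S * cmod (\<Sum>n\<in>I. e (real (nat \<bar>h\<bar>) * (of_int (x n) / real q)))
       \<le> real q / (4 * of_int \<bar>h\<bar>) * cmod (\<Sum>n\<in>I. e (real (nat \<bar>h\<bar>) * (of_int (x n) / real q)))"
      by (rule mult_right_mono) simp
    then show ?thesis unfolding eq by simp
  qed
qed

text \<open>Each of the \<open>H\<close> values of \<open>k\<close> in the expanded kernel
  contributes at most twice the sum over \<open>h\<close>, and the factor \<open>1 / H\<close> of
  the kernel cancels their number.\<close>

lemma norm_saw_fejer:
  assumes "0 < H" "2 * H \<le> q"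
  shows "\<bar>\<Sum>j\<in>{a..<a + int q}. (\<Sum>n\<in>I. saw q (x n + (c - j))) * fejer H q j\<bar>
    \<le> real q / 2 * (\<Sum>h=1..H. cmod (\<Sum>n\<in>I. e (real h * (of_int (x n) / real q))) / real h)"
proof -
  define w where "w = (\<lambda>h. cmod (\<Sum>n\<in>I. e (real h * (of_int (x n) / real q))) / real h)"
  define T where "T = (\<lambda>h. \<Sum>j\<in>{a..<a + int q}. (\<Sum>n\<in>I. complex_of_real (saw q (x n + c - j))) * e (of_int (h * j) / real q))"
  have "complex_of_real (\<Sum>j\<in>{a..<a + int q}. (\<Sum>n\<in>I. saw q (x n + (c - j))) * fejer H q j)
    = (\<Sum>j\<in>{a..<a + int q}. \<Sum>k<H. \<Sum>l<H. (\<Sum>n\<in>I. complex_of_real (saw q (x n + c - j))) * e (of_int ((int k - int l) * j) / real q)) / of_nat H"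
    by (simp only: of_real_fejer sum_divide_distrib sum_distrib_left add_diff_eq of_real_sum of_real_mult
        times_divide_eq_right)
  also have "\<dots> = (\<Sum>k<H. \<Sum>l<H. T (int k - int l)) / of_nat H"
    unfolding T_def by (subst sum_swap3) (rule refl)
  finally have "cmod (complex_of_real (\<Sum>j\<in>{a..<a + int q}. (\<Sum>n\<in>I. saw q (x n + (c - j))) * fejer H q j))
      = cmod ((\<Sum>k<H. \<Sum>l<H. T (int k - int l)) / of_nat H)"
    by (rule arg_cong)
  then have "\<bar>\<Sum>j\<in>{a..<a + int q}. (\<Sum>n\<in>I. saw q (x n + (c - j))) * fejer H q j\<bar>
      = cmod (\<Sum>k<H. \<Sum>l<H. T (int k - int l)) / real H"
    unfolding norm_of_real norm_divide norm_of_nat .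
  also have "\<dots> \<le> (\<Sum>k<H. \<Sum>l<H. real q / 4 * w (nat \<bar>int k - int l\<bar>)) / real H"
  proof (intro divide_right_mono sum_norm_le)
    fix k l assume "k \<in> {..<H}" "l \<in> {..<H}"
    then have "2 * \<bar>int k - int l\<bar> \<le> int q" "q > 0" using assms by (simp_all add: abs_if)
    then show "cmod (T (int k - int l)) \<le> real q / 4 * w (nat \<bar>int k - int l\<bar>)"
      unfolding w_def T_def by (intro norm_saw_twisted)
  qed simp
  also have "\<dots> = real q / 4 / real H * (\<Sum>k<H. \<Sum>l<H. w (nat \<bar>int k - int l\<bar>))"
    by (simp add: sum_distrib_left sum_divide_distrib)
  also have "\<dots> \<le> real q / 4 / real H * (\<Sum>k<H. 2 * (\<Sum>h=1..H. w h))"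
    by (intro mult_left_mono sum_mono sum_abs_diff_le) (auto simp: w_def)
  also have "\<dots> = real q / 2 * (\<Sum>h=1..H. w h)" using assms by simp
  finally show ?thesis by (simp add: w_def)
qed

section \<open>An Erdos-Turan inequality for the sawtooth\<close>

lemma saw_floor:
  assumes "q > 0"
  shows "\<bar>saw q \<lfloor>real q * y\<rfloor> - (frac y - 1/2)\<bar> \<le> 1 / real q"
proof -
  let ?m = "\<lfloor>real q * frac y\<rfloor>"
  \<comment> \<open>The integer part of \<open>y\<close> shifts the floor by a multiple of
    \<open>q\<close>, which \<open>saw\<close> ignores.\<close>
  have "real q * y = real q * frac y + of_int (int q * \<lfloor>y\<rfloor>)"
    by (simp add: frac_def algebra_simps)
  then have "\<lfloor>real q * y\<rfloor> = ?m + int q * \<lfloor>y\<rfloor>"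
    by (metis floor_add_int)
  moreover have "0 \<le> ?m" by simp
  moreover have "?m < int q" using assms frac_lt_1[of y] by (simp add: floor_less_iff)
  ultimately have m: "\<lfloor>real q * y\<rfloor> mod int q = ?m" by simp
  have "of_int ?m / real q \<le> frac y" "frac y < of_int ?m / real q + 1 / real q"
    using assms of_int_floor_le[of "real q * frac y"] real_of_int_floor_add_one_gt[of "real q * frac y"]
    by (simp_all add: field_simps)
  moreover have "1 / (2 * real q) = 1 / real q / 2" "0 \<le> 1 / real q" by simp_all
  ultimately show ?thesis unfolding saw_def m by linarith
qed

text \<open>The constant 11 is 8 from the plateau, at most 2 from moving the exponential sums to the
  grid, and 1 from moving the sawtooth there.\<close>

lemma erdos_turan_sawtooth:
  assumes "0 < H"
  shows "\<bar>\<Sum>n\<in>I. 1/2 - frac (y n)\<bar>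
    \<le> 11 * real (card I) / real H + (\<Sum>h=1..H. cmod (\<Sum>n\<in>I. e (real h * y n)) / real h)"
proof -
  \<comment> \<open>With \<open>J = 8 * H\<close> the tail bound \<open>2 * R^2 / (H * J)\<close> is
    exactly \<open>R / 2\<close>, and the plateau loss \<open>4 * J * N / q\<close> is
    \<open>8 * N / H\<close>.\<close>
  define R q J where "R = 2 * H\<^sup>2" "q = 2 * R" "J = 8 * H"
  define x where "x = (\<lambda>n. \<lfloor>real q * y n\<rfloor>)"
  define g where "g = (\<lambda>j. \<Sum>n\<in>I. saw q (x n + j))"
  define N where "N = real (card I)"
  have q: "real q = 4 * (real H)\<^sup>2" "q > 0" "R > 0" "J > 0"
    using assms by (auto simp: R_q_J_def)
  have Hq: "2 * H \<le> q" using assms by (auto simp: R_q_J_def power2_eq_square)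
  have qi: "{- int R..<int R} = {- int R..<- int R + int q}" by (simp add: R_q_J_def)
  have "\<bar>g 0\<bar> \<le> 4 * of_int (int J) * (N / real q) +
     (real q / 2 * (\<Sum>h=1..H. cmod (\<Sum>n\<in>I. e (real h * (of_int (x n) / real q))) / real h)) / of_int (int R)"
  proof (rule sup_le_convolution[where K = "fejer H q"])
    show "g (j + 2 * int R) = g j" for j
      using saw_periodic[of q "x n + j" for n] by (simp add: g_def R_q_J_def add_ac)
    show "g (j + 1) \<le> g j + N / real q" for j
    proof -
      have "g (j + 1) \<le> (\<Sum>n\<in>I. saw q (x n + j) + 1 / real q)"
        unfolding g_def using saw_Suc_le[OF \<open>q > 0\<close>] by (intro sum_mono) (simp flip: add.assoc)
      then show ?thesis by (simp add: g_def N_def sum.distrib)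
    qed
    show "(\<Sum>j\<in>{- int R..<int R}. fejer H q j) = 2 * of_int (int R)"
      using sum_fejer[of H q "- int R"] assms Hq unfolding qi by (simp add: R_q_J_def)
    have "(\<Sum>j\<in>{- int R..<int R} - {- int J..int J}. fejer H q j) \<le> 2 * (real R)\<^sup>2 / (real H * real J)"
      using fejer_tail[OF \<open>R > 0\<close> assms \<open>J > 0\<close>] by (simp add: R_q_J_def)
    also have "\<dots> = of_int (int R) / 2" using assms by (simp add: R_q_J_def power2_eq_square)
    finally show "(\<Sum>j\<in>{- int R..<int R} - {- int J..int J}. fejer H q j) \<le> of_int (int R) / 2" .
    show "\<bar>\<Sum>j\<in>{- int R..<int R}. g (c - j) * fejer H q j\<bar>
      \<le> real q / 2 * (\<Sum>h=1..H. cmod (\<Sum>n\<in>I. e (real h * (of_int (x n) / real q))) / real h)" for c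
      unfolding g_def qi by (rule norm_saw_fejer[OF assms Hq])
  qed (use q in \<open>auto simp: fejer_nonneg N_def\<close>)
  also have "\<dots> = 8 * N / real H + (\<Sum>h=1..H. cmod (\<Sum>n\<in>I. e (real h * (of_int (x n) / real q))) / real h)"
    using assms by (simp add: R_q_J_def power2_eq_square)
  \<comment> \<open>Rounding to the grid moves each phase by at most \<open>h / q\<close>. The
    weight \<open>1 / h\<close> removes the \<open>h\<close>, so \<open>H\<close> frequencies cost
    \<open>2 * pi * N * H / q\<close> in all.\<close>
  also have "(\<Sum>h=1..H. cmod (\<Sum>n\<in>I. e (real h * (of_int (x n) / real q))) / real h)
    \<le> (\<Sum>h=1..H. cmod (\<Sum>n\<in>I. e (real h * y n)) / real h + 2 * pi * N / real q)"
  proof (rule sum_mono)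
    fix h assume h: "h \<in> {1..H}"
    have "cmod ((\<Sum>n\<in>I. e (real h * (of_int (x n) / real q))) - (\<Sum>n\<in>I. e (real h * y n)))
      \<le> (\<Sum>n\<in>I. 2 * pi * (real h / real q))"
      unfolding sum_subtractf[symmetric]
    proof (rule sum_norm_le)
      fix n
      have "\<bar>of_int (x n) / real q - y n\<bar> \<le> 1 / real q"
      proof -
        have "\<bar>of_int (x n) - real q * y n\<bar> \<le> 1" unfolding x_def by linarith
        then have "\<bar>of_int (x n) - real q * y n\<bar> / real q \<le> 1 / real q"
          by (rule divide_right_mono) simp
        moreover have "\<bar>of_int (x n) - real q * y n\<bar> / real q = \<bar>(of_int (x n) - real q * y n) / real q\<bar>"
          by simp
        moreover have "(of_int (x n) - real q * y n) / real q = of_int (x n) / real q - y n"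
          using \<open>q > 0\<close> by (simp add: diff_divide_distrib)
        ultimately show ?thesis by simp
      qed
      then have "real h * \<bar>of_int (x n) / real q - y n\<bar> \<le> real h * (1 / real q)"
        by (intro mult_left_mono) auto
      moreover have "real h * (of_int (x n) / real q) - real h * y n = real h * (of_int (x n) / real q - y n)"
        by (rule right_diff_distrib[symmetric])
      ultimately have "\<bar>real h * (of_int (x n) / real q) - real h * y n\<bar> \<le> real h / real q"
        by (simp only: abs_mult) simp
      then have "2 * pi * \<bar>real h * (of_int (x n) / real q) - real h * y n\<bar> \<le> 2 * pi * (real h / real q)"
        by (intro mult_left_mono) auto
      then show "cmod (e (real h * (of_int (x n) / real q)) - e (real h * y n)) \<le> 2 * pi * (real h / real q)"
        using norm_e_diff_le by (rule order_trans[rotated])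
    qed
    also have "\<dots> = 2 * pi * N / real q * real h" by (simp add: N_def)
    finally have "cmod (\<Sum>n\<in>I. e (real h * (of_int (x n) / real q)))
      \<le> cmod (\<Sum>n\<in>I. e (real h * y n)) + 2 * pi * N / real q * real h"
      using norm_triangle_ineq2[of "\<Sum>n\<in>I. e (real h * (of_int (x n) / real q))" "\<Sum>n\<in>I. e (real h * y n)"]
      by linarith
    then show "cmod (\<Sum>n\<in>I. e (real h * (of_int (x n) / real q))) / real h
      \<le> cmod (\<Sum>n\<in>I. e (real h * y n)) / real h + 2 * pi * N / real q"
      using h by (simp add: field_simps)
  qed
  also have "\<dots> = (\<Sum>h=1..H. cmod (\<Sum>n\<in>I. e (real h * y n)) / real h) + pi / 2 * (N / real H)"
    using assms by (simp add: sum.distrib q power2_eq_square)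
  finally have g0: "\<bar>g 0\<bar> \<le> 8 * N / real H + ((\<Sum>h=1..H. cmod (\<Sum>n\<in>I. e (real h * y n)) / real h) + pi / 2 * (N / real H))"
    by simp
  \<comment> \<open>A plus sign, because \<open>saw\<close> approximates
    \<open>frac - 1/2\<close>.\<close>
  have "\<bar>g 0 + (\<Sum>n\<in>I. 1/2 - frac (y n))\<bar> \<le> (\<Sum>n\<in>I. 1 / real q)"
    unfolding g_def sum.distrib[symmetric]
  proof (intro order_trans[OF sum_abs] sum_mono)
    show "\<bar>saw q (x n + 0) + (1/2 - frac (y n))\<bar> \<le> 1 / real q" for n
      using saw_floor[OF \<open>q > 0\<close>, of "y n"] unfolding x_def add_0_right by linarith
  qed
  also have "\<dots> = N / real q" by (simp add: N_def)
  also have "\<dots> \<le> N / real H"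
    using assms Hq by (intro divide_left_mono) (auto simp: N_def)
  finally have "\<bar>\<Sum>n\<in>I. 1/2 - frac (y n)\<bar> \<le> \<bar>g 0\<bar> + N / real H" by linarith
  moreover have "pi / 2 * (N / real H) \<le> 2 * (N / real H)"
    using pi_less_4 by (intro mult_right_mono) (auto simp: N_def)
  ultimately show ?thesis using g0 by (simp add: N_def)
qed

section \<open>Partial summation with a monotone phase\<close>

lemma sum_by_parts:
  fixes a c :: "nat \<Rightarrow> 'a::comm_ring"
  shows "(\<Sum>n=1..Suc N. a n * c n)
    = (\<Sum>n=1..Suc N. a n) * c (Suc N) + (\<Sum>T=1..N. (\<Sum>n=1..T. a n) * (c T - c (Suc T)))"
  by (induction N) (simp_all add: algebra_simps)

text \<open>All differences have the same sign, so the sum telescopes.\<close>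

lemma variation_monotone_seq:
  assumes "monotone_seq \<gamma>"
  shows "(\<Sum>T=1..N. \<bar>\<gamma> T - \<gamma> (Suc T)\<bar>) = \<bar>\<gamma> (Suc N) - \<gamma> 1\<bar>"
  using assms unfolding monotone_seq_def
proof
  assume *: "mono_on {1..} \<gamma>"
  have "(\<Sum>T=1..N. \<bar>\<gamma> T - \<gamma> (Suc T)\<bar>) = \<gamma> (Suc N) - \<gamma> 1"
    using mono_onD[OF *, of "Suc N" "Suc (Suc N)" for N] by (induction N) auto
  then show ?thesis using mono_onD[OF *, of 1 "Suc N"] by simp
next
  assume *: "antimono_on {1..} \<gamma>"
  have "(\<Sum>T=1..N. \<bar>\<gamma> T - \<gamma> (Suc T)\<bar>) = \<gamma> 1 - \<gamma> (Suc N)"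
    using monotone_onD[OF *, of "Suc N" "Suc (Suc N)" for N] by (induction N) auto
  then show ?thesis using monotone_onD[OF *, of 1 "Suc N"] by simp
qed

lemma norm_partial_sum_le_M:
  assumes "1 \<le> T" "T \<le> N"
  shows "cmod (\<Sum>n=1..T. e (real h * u n)) \<le> M u N h"
  unfolding M_def using assms by (intro Max_ge) auto

text \<open>Abel summation against the unimodular \<open>c\<close>, whose total variation is at most
  \<open>2 * pi * h\<close> times that of \<open>\<gamma>\<close>.\<close>

lemma norm_sum_e_diff_le:
  assumes "monotone_seq \<gamma>" "N \<ge> 1"
  shows "cmod (\<Sum>n=1..N. e (real h * (u n - \<gamma> n))) \<le> M u N h * (1 + 2 * pi * real h * \<bar>\<gamma> N - \<gamma> 1\<bar>)"
proof -
  obtain K where N: "N = Suc K" using assms(2) by (cases N) auto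
  define c where "c = (\<lambda>n. e (- (real h * \<gamma> n)))"
  define S where "S = (\<lambda>T. \<Sum>n=1..T. e (real h * u n))"
  have S: "cmod (S T) \<le> M u N h" if "1 \<le> T" "T \<le> N" for T
    unfolding S_def using that by (rule norm_partial_sum_le_M)
  have M0: "M u N h \<ge> 0" using S[of N] assms(2) norm_ge_zero[of "S N"] by linarith
  have c: "cmod (c T - c (Suc T)) \<le> 2 * pi * real h * \<bar>\<gamma> T - \<gamma> (Suc T)\<bar>" for T
  proof -
    have "\<bar>- (real h * \<gamma> T) - - (real h * \<gamma> (Suc T))\<bar> = \<bar>real h * (\<gamma> T - \<gamma> (Suc T))\<bar>"
      by (simp add: right_diff_distrib abs_minus_commute)
    then show ?thesis
      using norm_e_diff_le[of "- (real h * \<gamma> T)" "- (real h * \<gamma> (Suc T))"]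
      unfolding c_def by (simp add: abs_mult)
  qed
  have "(\<Sum>n=1..N. e (real h * (u n - \<gamma> n))) = (\<Sum>n=1..N. e (real h * u n) * c n)"
    by (simp add: c_def right_diff_distrib flip: e_add)
  also have "\<dots> = S N * c N + (\<Sum>T=1..K. S T * (c T - c (Suc T)))"
    unfolding N S_def by (rule sum_by_parts)
  also have "cmod \<dots> \<le> M u N h * 1 + (\<Sum>T=1..K. M u N h * (2 * pi * real h * \<bar>\<gamma> T - \<gamma> (Suc T)\<bar>))"
  proof (intro order_trans[OF norm_triangle_ineq] add_mono sum_norm_le)
    show "cmod (S N * c N) \<le> M u N h * 1"
      using S[of N] assms(2) by (simp add: norm_mult c_def)
    show "cmod (S T * (c T - c (Suc T))) \<le> M u N h * (2 * pi * real h * \<bar>\<gamma> T - \<gamma> (Suc T)\<bar>)"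
      if "T \<in> {1..K}" for T
      unfolding norm_mult using S[of T] that M0 c[of T] N by (intro mult_mono) auto
  qed
  also have "\<dots> = M u N h * (1 + 2 * pi * real h * (\<Sum>T=1..K. \<bar>\<gamma> T - \<gamma> (Suc T)\<bar>))"
    by (simp add: sum_distrib_left algebra_simps)
  finally show ?thesis unfolding variation_monotone_seq[OF assms(1)] N .
qed

text \<open>Both signs of \<open>y\<close> are covered because the upper and lower bounds for
  \<open>D\<close> use opposite signs at the left endpoint.\<close>

lemma sawtooth_sum_bound:
  assumes "monotone_seq \<gamma>" "N \<ge> 1" "H \<ge> 1"
    and y: "(\<forall>n. y n = u n - \<gamma> n) \<or> (\<forall>n. y n = \<gamma> n - u n)"
  shows "\<bar>\<Sum>n=1..N. 1/2 - frac (y n)\<bar>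
    \<le> 11 * (real N / real H) + 8 * (1 + \<bar>\<gamma> N - \<gamma> 1\<bar>) * (\<Sum>h=1..H. M u N h)"
proof -
  let ?V = "\<bar>\<gamma> N - \<gamma> 1\<bar>"
  have M0: "M u N h \<ge> 0" for h
    using norm_partial_sum_le_M[of N N h u] assms(2) norm_ge_zero order_trans by blast
  have y': "cmod (\<Sum>n=1..N. e (real h * y n)) = cmod (\<Sum>n=1..N. e (real h * (u n - \<gamma> n)))" for h
    using y
  proof
    assume y: "\<forall>n. y n = \<gamma> n - u n"
    have "real h * (\<gamma> n - u n) = of_int (- int h) * (u n - \<gamma> n)" for n by (simp add: algebra_simps)
    then show ?thesis
      using norm_sum_e_abs[of "- int h" "\<lambda>n. u n - \<gamma> n" "{1..N}"] by (simp only: y[rule_format]) simp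
  qed simp
  have "cmod (\<Sum>n=1..N. e (real h * y n)) / real h \<le> 8 * (1 + ?V) * M u N h" if h: "h \<in> {1..H}" for h
  proof -
    \<comment> \<open>Bounding 1 by \<open>h\<close> and \<open>2 * pi\<close> by 8 makes the whole
      factor proportional to \<open>h\<close>, ready for division.\<close>
    have "1 + 2 * pi * real h * ?V \<le> real h * 1 + 8 * real h * ?V"
      using h pi_less_4 by (intro add_mono mult_right_mono) auto
    also have "\<dots> \<le> 8 * (1 + ?V) * real h" by (simp add: algebra_simps)
    finally have "M u N h * (1 + 2 * pi * real h * ?V) \<le> M u N h * (8 * (1 + ?V) * real h)"
      using M0 by (rule mult_left_mono)
    then have "cmod (\<Sum>n=1..N. e (real h * y n)) \<le> 8 * (1 + ?V) * M u N h * real h"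
      using norm_sum_e_diff_le[OF assms(1,2), of h u] y'[of h] by (simp add: mult_ac)
    then show ?thesis using h by (simp add: divide_le_eq)
  qed
  then have "(\<Sum>h=1..H. cmod (\<Sum>n=1..N. e (real h * y n)) / real h) \<le> (\<Sum>h=1..H. 8 * (1 + ?V) * M u N h)"
    by (rule sum_mono)
  then show ?thesis
    using erdos_turan_sawtooth[of H y "{1..N}"] assms(3) by (simp add: sum_distrib_left)
qed

section \<open>From the discrepancy to sawtooth sums\<close>

text \<open>The right-hand side is \<open>m - (b - a)\<close>, where \<open>m\<close> counts the
  integers \<open>k\<close> with \<open>x - k\<close> in the closed interval from \<open>a\<close>
  to \<open>b\<close>.\<close>

lemma indicator_le_sawtooth:
  assumes "a \<le> b"
  shows "of_bool (in_interval_mod1 x a b) - (b - a) \<le> (1/2 - frac (x - a)) + (1/2 - frac (b - x))"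
proof -
  define m where "m = 1 + \<lfloor>x - a\<rfloor> + \<lfloor>b - x\<rfloor>"
  have m: "(1/2 - frac (x - a)) + (1/2 - frac (b - x)) = of_int m - (b - a)"
    by (simp add: frac_def m_def)
  have "m \<ge> of_bool (in_interval_mod1 x a b)"
  proof (cases "in_interval_mod1 x a b")
    case True
    then obtain k :: int where "a \<le> x - of_int k" "x - of_int k \<le> b"
      unfolding in_interval_mod1_def by (metis Ints_cases diff_diff_eq2 add_diff_cancel_left' diff_add_cancel)
    then have "k \<le> \<lfloor>x - a\<rfloor>" "- k \<le> \<lfloor>b - x\<rfloor>" by (simp_all add: le_floor_iff)
    then show ?thesis by (simp add: m_def)
  next
    case False
    have "m > -1" unfolding m_def using assms by linarith
    with False show ?thesis by simp
  qed
  then have "real_of_int m \<ge> of_bool (in_interval_mod1 x a b)" by (cases "in_interval_mod1 x a b") simp_all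
  with m show ?thesis by simp
qed

text \<open>Reversing the argument at \<open>a\<close> drops the left endpoint: for
  \<open>a \<le> b\<close>, \<open>m\<close> counts the points congruent to \<open>x\<close> that
  exceed \<open>a\<close> and are at most \<open>b\<close>. Length at most 1 leaves room for only
  one.\<close>

lemma sawtooth_le_indicator:
  assumes "b \<le> a + 1"
  shows "(1/2 - frac (b - x)) - (1/2 - frac (a - x)) \<le> of_bool (in_interval_mod1 x a b) - (b - a)"
proof -
  define m where "m = \<lfloor>b - x\<rfloor> - \<lfloor>a - x\<rfloor>"
  have m: "(1/2 - frac (b - x)) - (1/2 - frac (a - x)) = of_int m - (b - a)"
    by (simp add: frac_def m_def)
  have "m \<le> of_bool (in_interval_mod1 x a b)"
  proof (cases "in_interval_mod1 x a b")
    case True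
    then show ?thesis unfolding m_def using assms by simp linarith
  next
    case False
    have "m \<le> 0"
    proof (rule ccontr)
      assume "\<not> m \<le> 0"
      then have "\<lfloor>a - x\<rfloor> < \<lfloor>b - x\<rfloor>" by (simp add: m_def)
      \<comment> \<open>The witness is the largest point congruent to \<open>x\<close> that does not
        exceed \<open>b\<close>.\<close>
      then have "a \<le> x + of_int \<lfloor>b - x\<rfloor>" "x + of_int \<lfloor>b - x\<rfloor> \<le> b" by linarith+
      then have "in_interval_mod1 x a b"
        unfolding in_interval_mod1_def by (intro exI[of _ "x + of_int \<lfloor>b - x\<rfloor>"]) simp
      with False show False by simp
    qed
    with False show ?thesis by simp
  qed
  then have "real_of_int m \<le> of_bool (in_interval_mod1 x a b)" by (cases "in_interval_mod1 x a b") simp_all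
  with m show ?thesis by simp
qed

lemma D_eq_sum:
  "D u \<alpha> \<beta> N = (\<Sum>n=1..N. of_bool (in_interval_mod1 (u n) (\<alpha> n) (\<beta> n)) - (\<beta> n - \<alpha> n))"
  by (simp add: D_def Z_def sum_subtractf of_bool_def Collect_conj_eq Int_commute flip: sum.inter_filter)

theorem corollary1p3:
  shows "\<exists>C::real. \<forall>(u :: nat \<Rightarrow> real) (\<alpha> :: nat \<Rightarrow> real) (\<beta> :: nat \<Rightarrow> real).
    (\<forall>n\<ge>1. \<alpha> n \<le> \<beta> n \<and> \<beta> n \<le> \<alpha> n + 1) \<longrightarrow> monotone_seq \<alpha> \<longrightarrow> monotone_seq \<beta> \<longrightarrow>
    (\<forall>N H :: nat. N \<ge> 1 \<longrightarrow> H \<ge> 1 \<longrightarrow>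
      \<bar>D u \<alpha> \<beta> N\<bar> \<le> C * (real N / real H
        + (1 + \<bar>\<alpha> N - \<alpha> 1\<bar> + \<bar>\<beta> N - \<beta> 1\<bar>) * (\<Sum>h=1..H. M u N h)))"
proof (intro exI[of _ 22] allI impI)
  fix u \<alpha> \<beta> :: "nat \<Rightarrow> real" and N H :: nat
  assume ab: "\<forall>n\<ge>1. \<alpha> n \<le> \<beta> n \<and> \<beta> n \<le> \<alpha> n + 1"
    and mono: "monotone_seq \<alpha>" "monotone_seq \<beta>" and NH: "N \<ge> 1" "H \<ge> 1"
  define s where "s = (\<Sum>h=1..H. M u N h)"
  define E where "E = (\<lambda>\<gamma>::nat \<Rightarrow> real. 11 * (real N / real H) + 8 * (1 + \<bar>\<gamma> N - \<gamma> 1\<bar>) * s)"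
  have s: "s \<ge> 0" unfolding s_def
    using norm_partial_sum_le_M[of N N _ u] NH norm_ge_zero order_trans by (intro sum_nonneg) blast
  have "D u \<alpha> \<beta> N \<le> (\<Sum>n=1..N. (1/2 - frac (u n - \<alpha> n)) + (1/2 - frac (\<beta> n - u n)))"
    unfolding D_eq_sum using ab by (intro sum_mono indicator_le_sawtooth) simp
  also have "\<dots> = (\<Sum>n=1..N. 1/2 - frac (u n - \<alpha> n)) + (\<Sum>n=1..N. 1/2 - frac (\<beta> n - u n))"
    by (rule sum.distrib)
  finally have upper: "D u \<alpha> \<beta> N \<le> E \<alpha> + E \<beta>"
    using sawtooth_sum_bound[OF mono(1) NH, of "\<lambda>n. u n - \<alpha> n" u]
      sawtooth_sum_bound[OF mono(2) NH, of "\<lambda>n. \<beta> n - u n" u]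
    unfolding E_def s_def by (simp add: abs_le_iff)
  have "D u \<alpha> \<beta> N \<ge> (\<Sum>n=1..N. (1/2 - frac (\<beta> n - u n)) - (1/2 - frac (\<alpha> n - u n)))"
    unfolding D_eq_sum using ab by (intro sum_mono sawtooth_le_indicator) simp
  moreover have "(\<Sum>n=1..N. (1/2 - frac (\<beta> n - u n)) - (1/2 - frac (\<alpha> n - u n)))
      = (\<Sum>n=1..N. 1/2 - frac (\<beta> n - u n)) - (\<Sum>n=1..N. 1/2 - frac (\<alpha> n - u n))"
    by (rule sum_subtractf)
  ultimately have lower: "- D u \<alpha> \<beta> N \<le> E \<alpha> + E \<beta>"
    using sawtooth_sum_bound[OF mono(1) NH, of "\<lambda>n. \<alpha> n - u n" u]
      sawtooth_sum_bound[OF mono(2) NH, of "\<lambda>n. \<beta> n - u n" u]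
    unfolding E_def s_def by (simp add: abs_le_iff)
  \<comment> \<open>\<open>E \<alpha> + E \<beta>\<close> has coefficients 22, 16, 8 and 8; these
    terms are the slack \<open>22 - 16\<close> and \<open>22 - 8\<close>.\<close>
  have "0 \<le> 6 * s" "0 \<le> 14 * (\<bar>\<alpha> N - \<alpha> 1\<bar> * s)" "0 \<le> 14 * (\<bar>\<beta> N - \<beta> 1\<bar> * s)"
    using s by simp_all
  then have "E \<alpha> + E \<beta> \<le> 22 * (real N / real H + (1 + \<bar>\<alpha> N - \<alpha> 1\<bar> + \<bar>\<beta> N - \<beta> 1\<bar>) * s)"
    unfolding E_def ring_distribs mult_1_left by linarith
  with upper lower show "\<bar>D u \<alpha> \<beta> N\<bar> \<le> 22 * (real N / real H
        + (1 + \<bar>\<alpha> N - \<alpha> 1\<bar> + \<bar>\<beta> N - \<beta> 1\<bar>) * (\<Sum>h=1..H. M u N h))"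
    unfolding s_def by linarith
qed

end
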